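(* It is decidable whether a given finite forest category (finitely many objects, arrows and half-arrows, with all operations given explicitly) is globally idempotent and commutative.
   Context: Forest algebras. A forest algebra $(H,V)$ consists of a commutative monoid $H$ (additive, identity $0$), a monoid $V$, and a faithful right action $H\times V\to H$ such that for $v\in V$, $h\in H$ there is $v+h\in V$ with $g(v+h)=gv+h$ for all $g\in H$. If $H$ is an idempotent commutative monoid, $H$ acting on itself by $hv=h+v$ gives a forest algebra $(H,H)$, called a flat idempotent and commutative forest algebra. Forest categories. A forest category $\mathcal C$ consists of: a finite set $\mathrm{Obj}(\mathcal C)$ which is a commutative monoid under $+$ with identity $0$; for all objects $x,y$ a set $\mathrm{Arr}(x,y)$ of arrows (pairwise disjoint); for each object $x$ a set $\mathrm{HArr}(x)$ of half-arrows to $x$ (pairwise disjoint), subject to: (1) the set of all half-arrows is a commutative monoid under $+$ with $\mathrm{HArr}(x)+\mathrm{HArr}(y)\subseteq\mathrm{HArr}(x+y)$, the end map being a homomorphism onto $\mathrm{Obj}(\mathcal C)$; (2) an associative composition $\mathrm{Arr}(x,y)\times\mathrm{Arr}(y,z)\to\mathrm{Arr}(x,z)$ with identity arrows $1_x$; (3) an action $\mathrm{HArr}(x)\times\mathrm{Arr}(x,y)\to\mathrm{HArr}(y)$, $(c,u)\mapsto cu$, with $(cu)v=c(uv)$, $c1_x=c$, faithful (if $cu=cu'$ for all $c\in\mathrm{HArr}(x)$ then $u=u'$); (4) for $u\in\mathrm{Arr}(x,y)$, $c\in\mathrm{HArr}(z)$ an arrow $u+c\in\mathrm{Arr}(x,y+z)$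 with $f(u+c)=(fu)+c$ for all $f\in\mathrm{Arr}(w,x)$ and $(u+c)+d=u+(c+d)$. Division. $\mathcal C\prec(H,V)$ means: there are nonempty sets $K_c\subseteq H$ for each half-arrow $c$ and $K_u\subseteq V$ for each arrow $u$ with $K_uK_v\subseteq K_{uv}$, $K_cK_u\subseteq K_{cu}$, $K_c+K_d\subseteq K_{c+d}$, $K_u+K_c\subseteq K_{u+c}$ whenever defined, and distinct arrows in the same $\mathrm{Arr}(x,y)$ (resp. distinct half-arrows in the same $\mathrm{HArr}(y)$) have disjoint covering sets. $\mathcal C$ is globally idempotent and commutative if it divides some flat idempotent and commutative forest algebra. *)

theory Defs
  imports "HOL-Algebra.Group" "HOL-Algebra.FiniteProduct" "HOL-Library.Nat_Bijection"
begin

section \<open>Forest algebras\<close>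

text \<open>
  All monoids are records of HOL-Algebra, whose operation is written multiplicatively; the additive
  monoids of the theory (forests, objects, half-arrows) are represented in the same way, with
  \<open>\<otimes>\<close> in the role of \<open>+\<close> and \<open>\<one>\<close> in the role of \<open>0\<close>.
  Actions are on the right: \<open>fa_act A h v\<close> is \<open>hv\<close>, and \<open>fa_ins A v h\<close> is \<open>v + h\<close>.
\<close>

record ('h, 'v) forest_alg =
  fa_hor :: "'h monoid"
  fa_ver :: "'v monoid"
  fa_act :: "'h \<Rightarrow> 'v \<Rightarrow> 'h"
  fa_ins :: "'v \<Rightarrow> 'h \<Rightarrow> 'v"

locale forest_algebra =
  fixes A :: "('h, 'v) forest_alg"
  assumes hor_monoid: "comm_monoid (fa_hor A)"
    and ver_monoid: "monoid (fa_ver A)"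
    and act_closed:
      "\<lbrakk>h \<in> carrier (fa_hor A); v \<in> carrier (fa_ver A)\<rbrakk> \<Longrightarrow> fa_act A h v \<in> carrier (fa_hor A)"
    and act_mult:
      "\<lbrakk>h \<in> carrier (fa_hor A); v \<in> carrier (fa_ver A); w \<in> carrier (fa_ver A)\<rbrakk> \<Longrightarrow>
         fa_act A h (v \<otimes>\<^bsub>fa_ver A\<^esub> w) = fa_act A (fa_act A h v) w"
    and act_one: "h \<in> carrier (fa_hor A) \<Longrightarrow> fa_act A h \<one>\<^bsub>fa_ver A\<^esub> = h"
    and act_faithful:
      "\<lbrakk>v \<in> carrier (fa_ver A); w \<in> carrier (fa_ver A);
        \<And>h. h \<in> carrier (fa_hor A) \<Longrightarrow> fa_act A h v = fa_act A h w\<rbrakk> \<Longrightarrow> v = w"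
    and ins_closed:
      "\<lbrakk>v \<in> carrier (fa_ver A); h \<in> carrier (fa_hor A)\<rbrakk> \<Longrightarrow> fa_ins A v h \<in> carrier (fa_ver A)"
    and act_ins:
      "\<lbrakk>g \<in> carrier (fa_hor A); v \<in> carrier (fa_ver A); h \<in> carrier (fa_hor A)\<rbrakk> \<Longrightarrow>
         fa_act A g (fa_ins A v h) = fa_act A g v \<otimes>\<^bsub>fa_hor A\<^esub> h"

definition idem_comm_monoid :: "'h monoid \<Rightarrow> bool" where
  "idem_comm_monoid H \<longleftrightarrow> comm_monoid H \<and> (\<forall>h\<in>carrier H. h \<otimes>\<^bsub>H\<^esub> h = h)"

definition flat_alg :: "'h monoid \<Rightarrow> ('h, 'h) forest_alg" where
  "flat_alg H = \<lparr>fa_hor = H, fa_ver = H,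
     fa_act = (\<lambda>h v. h \<otimes>\<^bsub>H\<^esub> v), fa_ins = (\<lambda>v h. v \<otimes>\<^bsub>H\<^esub> h)\<rparr>"

lemma forest_algebra_flat_alg:
  assumes "idem_comm_monoid H"
  shows "forest_algebra (flat_alg H)"
proof -
  interpret comm_monoid H using assms by (simp add: idem_comm_monoid_def)
  show ?thesis
  proof
    fix v w
    assume vw: "v \<in> carrier (fa_ver (flat_alg H))" "w \<in> carrier (fa_ver (flat_alg H))"
      and eq: "\<And>h. h \<in> carrier (fa_hor (flat_alg H)) \<Longrightarrow>
        fa_act (flat_alg H) h v = fa_act (flat_alg H) h w"
    show "v = w"
      using vw eq[of "\<one>\<^bsub>H\<^esub>"] by (simp add: flat_alg_def)
  qed (auto simp: flat_alg_def m_assoc m_lcomm m_comm)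
qed

section \<open>Forest categories\<close>

text \<open>
  The disjoint families of sets \<open>Arr(x, y)\<close> and \<open>HArr(x)\<close> are given by their unions \<open>arrows\<close> and
  \<open>carrier (half)\<close>, together with the maps sending an arrow to its source and target
  and a half-arrow to its end. Values of the operations at arguments where they are not
  defined in the category are irrelevant.
\<close>

record ('o, 'a, 'c) forest_cat =
  obj :: "'o monoid"
  arrows :: "'a set"
  src :: "'a \<Rightarrow> 'o"
  tgt :: "'a \<Rightarrow> 'o"
  half :: "'c monoid"
  hend :: "'c \<Rightarrow> 'o"
  cmp :: "'a \<Rightarrow> 'a \<Rightarrow> 'a"
  ident :: "'o \<Rightarrow> 'a"
  hact :: "'c \<Rightarrow> 'a \<Rightarrow> 'c"
  ains :: "'a \<Rightarrow> 'c \<Rightarrow> 'a"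

definition Arr :: "('o, 'a, 'c) forest_cat \<Rightarrow> 'o \<Rightarrow> 'o \<Rightarrow> 'a set" where
  "Arr C x y = {u \<in> arrows C. src C u = x \<and> tgt C u = y}"

definition HArr :: "('o, 'a, 'c) forest_cat \<Rightarrow> 'o \<Rightarrow> 'c set" where
  "HArr C x = {c \<in> carrier (half C). hend C c = x}"

text \<open>
  In \<open>half_end\<close>, a surjective multiplicative map between commutative monoids also preserves
  the neutral element.
\<close>

locale forest_category =
  fixes C :: "('o, 'a, 'c) forest_cat"
  assumes finite_obj: "finite (carrier (obj C))"
    and obj_monoid: "comm_monoid (obj C)"
    and src_obj: "u \<in> arrows C \<Longrightarrow> src C u \<in> carrier (obj C)"
    and tgt_obj: "u \<in> arrows C \<Longrightarrow> tgt C u \<in> carrier (obj C)"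
    and half_monoid: "comm_monoid (half C)"
    and half_end: "hend C \<in> epi (half C) (obj C)"
    and cmp_in: "\<lbrakk>u \<in> Arr C x y; v \<in> Arr C y z\<rbrakk> \<Longrightarrow> cmp C u v \<in> Arr C x z"
    and cmp_assoc:
      "\<lbrakk>u \<in> Arr C w x; v \<in> Arr C x y; t \<in> Arr C y z\<rbrakk> \<Longrightarrow>
         cmp C (cmp C u v) t = cmp C u (cmp C v t)"
    and ident_in: "x \<in> carrier (obj C) \<Longrightarrow> ident C x \<in> Arr C x x"
    and ident_left: "u \<in> Arr C x y \<Longrightarrow> cmp C (ident C x) u = u"
    and ident_right: "u \<in> Arr C x y \<Longrightarrow> cmp C u (ident C y) = u"
    and hact_in: "\<lbrakk>c \<in> HArr C x; u \<in> Arr C x y\<rbrakk> \<Longrightarrow> hact C c u \<in> HArr C y"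
    and hact_cmp:
      "\<lbrakk>c \<in> HArr C x; u \<in> Arr C x y; v \<in> Arr C y z\<rbrakk> \<Longrightarrow>
         hact C (hact C c u) v = hact C c (cmp C u v)"
    and hact_ident: "c \<in> HArr C x \<Longrightarrow> hact C c (ident C x) = c"
    and hact_faithful:
      "\<lbrakk>u \<in> Arr C x y; v \<in> Arr C x y;
        \<And>c. c \<in> HArr C x \<Longrightarrow> hact C c u = hact C c v\<rbrakk> \<Longrightarrow> u = v"
    and ains_in:
      "\<lbrakk>u \<in> Arr C x y; c \<in> HArr C z\<rbrakk> \<Longrightarrow> ains C u c \<in> Arr C x (y \<otimes>\<^bsub>obj C\<^esub> z)"
    and cmp_ains:
      "\<lbrakk>f \<in> Arr C w x; u \<in> Arr C x y; c \<in> HArr C z\<rbrakk> \<Longrightarrow>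
         cmp C f (ains C u c) = ains C (cmp C f u) c"
    and ains_ains:
      "\<lbrakk>u \<in> Arr C x y; c \<in> carrier (half C); d \<in> carrier (half C)\<rbrakk> \<Longrightarrow>
         ains C (ains C u c) d = ains C u (c \<otimes>\<^bsub>half C\<^esub> d)"

locale finite_forest_category = forest_category +
  assumes finite_arrows: "finite (arrows C)"
    and finite_half: "finite (carrier (half C))"

section \<open>Division\<close>

definition divides :: "('o, 'a, 'c) forest_cat \<Rightarrow> ('h, 'v) forest_alg \<Rightarrow> bool" where
  "divides C A \<longleftrightarrow>
     (\<exists>(K :: 'c \<Rightarrow> 'h set) (L :: 'a \<Rightarrow> 'v set).
        (\<forall>c\<in>carrier (half C). K c \<noteq> {} \<and> K c \<subseteq> carrier (fa_hor A)) \<and>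
        (\<forall>u\<in>arrows C. L u \<noteq> {} \<and> L u \<subseteq> carrier (fa_ver A)) \<and>
        (\<forall>x y z. \<forall>u\<in>Arr C x y. \<forall>v\<in>Arr C y z. \<forall>k\<in>L u. \<forall>l\<in>L v.
           k \<otimes>\<^bsub>fa_ver A\<^esub> l \<in> L (cmp C u v)) \<and>
        (\<forall>x y. \<forall>c\<in>HArr C x. \<forall>u\<in>Arr C x y. \<forall>k\<in>K c. \<forall>l\<in>L u.
           fa_act A k l \<in> K (hact C c u)) \<and>
        (\<forall>c\<in>carrier (half C). \<forall>d\<in>carrier (half C). \<forall>k\<in>K c. \<forall>l\<in>K d.
           k \<otimes>\<^bsub>fa_hor A\<^esub> l \<in> K (c \<otimes>\<^bsub>half C\<^esub> d)) \<and>
        (\<forall>u\<in>arrows C. \<forall>c\<in>carrier (half C). \<forall>k\<in>L u. \<forall>l\<in>K c.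
           fa_ins A k l \<in> L (ains C u c)) \<and>
        (\<forall>x y. \<forall>u\<in>Arr C x y. \<forall>v\<in>Arr C x y. u \<noteq> v \<longrightarrow> L u \<inter> L v = {}) \<and>
        (\<forall>x. \<forall>c\<in>HArr C x. \<forall>d\<in>HArr C x. c \<noteq> d \<longrightarrow> K c \<inter> K d = {}))"

text \<open>
  The idempotent commutative monoid is sought with carrier in \<^typ>\<open>nat\<close>, since one cannot quantify
  over types. For categories with finitely many arrows and half-arrows this is no restriction:
  see \<open>globally_idem_commI\<close> below.
\<close>

definition globally_idem_comm :: "('o, 'a, 'c) forest_cat \<Rightarrow> bool" where
  "globally_idem_comm C \<longleftrightarrow>
     (\<exists>H :: nat monoid. idem_comm_monoid H \<and> divides C (flat_alg H))"

lemma finprod_idem_Un: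
  assumes "idem_comm_monoid H" "finite S" "finite T" "S \<union> T \<subseteq> carrier H"
  shows "finprod H (\<lambda>x. x) (S \<union> T) = finprod H (\<lambda>x. x) S \<otimes>\<^bsub>H\<^esub> finprod H (\<lambda>x. x) T"
proof -
  interpret comm_monoid H using assms by (simp add: idem_comm_monoid_def)
  have idem: "h \<otimes>\<^bsub>H\<^esub> h = h" if "h \<in> carrier H" for h
    using assms that by (simp add: idem_comm_monoid_def)
  have absorb: "a \<otimes>\<^bsub>H\<^esub> finprod H (\<lambda>x. x) U = finprod H (\<lambda>x. x) U"
    if "finite U" "U \<subseteq> carrier H" "a \<in> U" for a U
  proof -
    have "finprod H (\<lambda>x. x) U = a \<otimes>\<^bsub>H\<^esub> finprod H (\<lambda>x. x) (U - {a})"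
      using that finprod_insert[of "U - {a}" a "\<lambda>x. x"]
      by (simp add: insert_absorb subset_iff Pi_iff)
    moreover have "finprod H (\<lambda>x. x) (U - {a}) \<in> carrier H" "a \<in> carrier H"
      using that by (auto intro!: finprod_closed)
    ultimately show ?thesis using idem by (simp add: m_assoc[symmetric])
  qed
  from assms(2,3,4) show ?thesis
  proof (induction S rule: finite_induct)
    case empty
    then show ?case by (auto intro!: l_one[symmetric] finprod_closed)
  next
    case (insert a S)
    then have c: "a \<in> carrier H" "finprod H (\<lambda>x. x) S \<in> carrier H" "finprod H (\<lambda>x. x) T \<in> carrier H"
      by (auto intro!: finprod_closed)
    have ST: "finprod H (\<lambda>x. x) (S \<union> T) = finprod H (\<lambda>x. x) S \<otimes>\<^bsub>H\<^esub> finprod H (\<lambda>x. x) T"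
      using insert by auto
    have "finprod H (\<lambda>x. x) (insert a S) = a \<otimes>\<^bsub>H\<^esub> finprod H (\<lambda>x. x) S"
      using insert by (subst finprod_insert) auto
    moreover have "finprod H (\<lambda>x. x) (insert a (S \<union> T)) = a \<otimes>\<^bsub>H\<^esub> finprod H (\<lambda>x. x) (S \<union> T)"
    proof (cases "a \<in> T")
      case True
      then have "insert a (S \<union> T) = S \<union> T" by auto
      then show ?thesis using absorb[of "S \<union> T" a] True insert by auto
    next
      case False
      then show ?thesis using insert by (subst finprod_insert) auto
    qed
    ultimately show ?case using c ST by (simp add: m_assoc)
  qed
qed

lemma globally_idem_commI:
  fixes C :: "('o, 'a, 'c) forest_cat" and H :: "'h monoid"
  assumes fin: "finite (arrows C)" "finite (carrier (half C))"
    and H: "idem_comm_monoid H" and div: "divides C (flat_alg H)"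
  shows "globally_idem_comm C"
proof -
  interpret comm_monoid H using H by (simp add: idem_comm_monoid_def)
  obtain K L where
    K: "\<forall>c\<in>carrier (half C). K c \<noteq> {} \<and> K c \<subseteq> carrier H"
    and L: "\<forall>u\<in>arrows C. L u \<noteq> {} \<and> L u \<subseteq> carrier H"
    and LL: "\<forall>x y z. \<forall>u\<in>Arr C x y. \<forall>v\<in>Arr C y z. \<forall>k\<in>L u. \<forall>l\<in>L v.
      k \<otimes>\<^bsub>H\<^esub> l \<in> L (cmp C u v)"
    and KL: "\<forall>x y. \<forall>c\<in>HArr C x. \<forall>u\<in>Arr C x y. \<forall>k\<in>K c. \<forall>l\<in>L u.
      k \<otimes>\<^bsub>H\<^esub> l \<in> K (hact C c u)"
    and KK: "\<forall>c\<in>carrier (half C). \<forall>d\<in>carrier (half C). \<forall>k\<in>K c. \<forall>l\<in>K d.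
      k \<otimes>\<^bsub>H\<^esub> l \<in> K (c \<otimes>\<^bsub>half C\<^esub> d)"
    and LK: "\<forall>u\<in>arrows C. \<forall>c\<in>carrier (half C). \<forall>k\<in>L u. \<forall>l\<in>K c.
      k \<otimes>\<^bsub>H\<^esub> l \<in> L (ains C u c)"
    and disL: "\<forall>x y. \<forall>u\<in>Arr C x y. \<forall>v\<in>Arr C x y. u \<noteq> v \<longrightarrow> L u \<inter> L v = {}"
    and disK: "\<forall>x. \<forall>c\<in>HArr C x. \<forall>d\<in>HArr C x. c \<noteq> d \<longrightarrow> K c \<inter> K d = {}"
    using div unfolding divides_def flat_alg_def forest_alg.simps
    by (elim exE conjE) (rule that)
  define G where "G = (\<lambda>c. SOME k. k \<in> K c) ` carrier (half C) \<union> (\<lambda>u. SOME k. k \<in> L u) ` arrows C"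
  have someK: "(SOME k. k \<in> K c) \<in> K c" if "c \<in> carrier (half C)" for c
    using K[rule_format, OF that] by (auto intro: someI_ex)
  have someL: "(SOME k. k \<in> L u) \<in> L u" if "u \<in> arrows C" for u
    using L[rule_format, OF that] by (auto intro: someI_ex)
  have finG: "finite G" using fin by (simp add: G_def)
  have GH: "G \<subseteq> carrier H" using K L someK someL unfolding G_def by blast
  define F where "F = finprod H (\<lambda>x. x) ` Pow G"
  have finF: "finite F" using finG by (simp add: F_def)
  have FH: "F \<subseteq> carrier H"
    using GH by (auto simp: F_def intro!: finprod_closed)
  have GF: "G \<subseteq> F"
  proof
    fix g assume g: "g \<in> G"
    then have "finprod H (\<lambda>x. x) {g} = g" using GH by (subst finprod_insert) auto
    then show "g \<in> F" using g unfolding F_def by (auto intro!: image_eqI[of _ _ "{g}"])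
  qed
  have oneF: "\<one>\<^bsub>H\<^esub> \<in> F" unfolding F_def by (auto intro!: image_eqI[of _ _ "{}"])
  have multF: "a \<otimes>\<^bsub>H\<^esub> b \<in> F" if "a \<in> F" "b \<in> F" for a b
  proof -
    obtain S T where ST: "S \<subseteq> G" "T \<subseteq> G" "a = finprod H (\<lambda>x. x) S" "b = finprod H (\<lambda>x. x) T"
      using \<open>a \<in> F\<close> \<open>b \<in> F\<close> by (auto simp: F_def)
    then have "finprod H (\<lambda>x. x) (S \<union> T) = a \<otimes>\<^bsub>H\<^esub> b"
      using finprod_idem_Un[OF H, of S T] finG GH by (auto dest: finite_subset)
    then show ?thesis using ST unfolding F_def by (metis Pow_iff Un_subset_iff imageI)
  qed
  obtain e :: "'h \<Rightarrow> nat" where e: "inj_on e F"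
    using finF finite_imp_inj_to_nat_seg by blast
  define r where "r = inv_into F e"
  have re: "r (e a) = a" if "a \<in> F" for a using e that by (simp add: r_def)
  define N where "N = \<lparr>carrier = e ` F, mult = (\<lambda>i j. e (r i \<otimes>\<^bsub>H\<^esub> r j)), one = e \<one>\<^bsub>H\<^esub>\<rparr>"
  have cN: "carrier N = e ` F" and oN: "\<one>\<^bsub>N\<^esub> = e \<one>\<^bsub>H\<^esub>"
    by (simp_all add: N_def)
  have mN: "e a \<otimes>\<^bsub>N\<^esub> e b = e (a \<otimes>\<^bsub>H\<^esub> b)" if "a \<in> F" "b \<in> F" for a b
    using that by (simp add: N_def re)
  have FHD: "a \<in> carrier H" if "a \<in> F" for a using FH that by auto
  have "comm_monoid N"
    by (rule comm_monoidI)
      (auto simp: cN oN mN multF oneF FHD m_ac)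
  moreover have "h \<otimes>\<^bsub>N\<^esub> h = h" if "h \<in> carrier N" for h
    using that H FHD by (auto simp: cN mN idem_comm_monoid_def)
  ultimately have N: "idem_comm_monoid N" by (simp add: idem_comm_monoid_def)
  have "divides C (flat_alg N)"
    unfolding divides_def flat_alg_def forest_alg.simps
  proof (intro exI[of _ "\<lambda>c. e ` (K c \<inter> F)"] exI[of _ "\<lambda>u. e ` (L u \<inter> F)"] conjI ballI allI impI)
    fix c assume c: "c \<in> carrier (half C)"
    show "e ` (K c \<inter> F) \<noteq> {}" using someK[OF c] GF c by (auto simp: G_def)
    show "e ` (K c \<inter> F) \<subseteq> carrier N" by (auto simp: cN)
  next
    fix u assume u: "u \<in> arrows C"
    show "e ` (L u \<inter> F) \<noteq> {}" using someL[OF u] GF u by (auto simp: G_def)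
    show "e ` (L u \<inter> F) \<subseteq> carrier N" by (auto simp: cN)
  next
    fix x y u v assume "u \<in> Arr C x y" "v \<in> Arr C x y" "u \<noteq> v"
    then show "e ` (L u \<inter> F) \<inter> e ` (L v \<inter> F) = {}"
      using disL e by (fastforce dest: inj_onD)
  next
    fix x c d assume "c \<in> HArr C x" "d \<in> HArr C x" "c \<noteq> d"
    then show "e ` (K c \<inter> F) \<inter> e ` (K d \<inter> F) = {}"
      using disK e by (fastforce dest: inj_onD)
  qed (auto simp: mN multF intro!: imageI LL[rule_format] KL[rule_format]
      KK[rule_format] LK[rule_format])
  with N show ?thesis unfolding globally_idem_comm_def by blast
qed

section \<open>Decidability\<close>

text \<open>
  \<open>recursive n f\<close>: the function \<open>f\<close>, applied to argument lists of length \<open>n\<close>, is a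
  total recursive function of \<open>n\<close> arguments. Its values at lists of other lengths play no role.
  Minimization is restricted to regular functions, which yields exactly the
  total functions among the partial recursive ones.
\<close>

inductive recursive :: "nat \<Rightarrow> (nat list \<Rightarrow> nat) \<Rightarrow> bool" where
  zero: "recursive n (\<lambda>xs. 0)"
| succ: "recursive 1 (\<lambda>xs. Suc (xs ! 0))"
| proj: "i < n \<Longrightarrow> recursive n (\<lambda>xs. xs ! i)"
| subst: "\<lbrakk>recursive (length fs) g; \<forall>f\<in>set fs. recursive n f\<rbrakk> \<Longrightarrow>
    recursive n (\<lambda>xs. g (map (\<lambda>f. f xs) fs))"
| prim_rec: "\<lbrakk>recursive n f; recursive (Suc (Suc n)) g\<rbrakk> \<Longrightarrow>
    recursive (Suc n) (\<lambda>xs. rec_nat (f (tl xs)) (\<lambda>k r. g (k # r # tl xs)) (hd xs))"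
| minimize: "\<lbrakk>recursive (Suc n) f; \<forall>xs. length xs = n \<longrightarrow> (\<exists>k. f (k # xs) = 0)\<rbrakk> \<Longrightarrow>
    recursive n (\<lambda>xs. LEAST k. f (k # xs) = 0)"

definition decidable_problem :: "('i \<Rightarrow> nat) \<Rightarrow> 'i set \<Rightarrow> ('i \<Rightarrow> bool) \<Rightarrow> bool" where
  "decidable_problem code I P \<longleftrightarrow>
     (\<exists>f. recursive 1 f \<and> (\<forall>x\<in>I. f [code x] = (if P x then 1 else 0)))"

text \<open>
  Up to isomorphism, the objects, arrows and half-arrows of a finite forest category are natural
  numbers, not necessarily initial segments. Such a category is coded by listing the underlying sets, the distinguished elements, and the graphs of all operations
  (restricted to the arguments where they are defined).
\<close>

definition graph1_code :: "(nat \<times> nat) set \<Rightarrow> nat" where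
  "graph1_code R = set_encode (prod_encode ` R)"

definition graph2_code :: "(nat \<times> nat \<times> nat) set \<Rightarrow> nat" where
  "graph2_code R = set_encode ((\<lambda>(x, y, z). prod_encode (x, prod_encode (y, z))) ` R)"

definition forest_cat_code :: "(nat, nat, nat) forest_cat \<Rightarrow> nat" where
  "forest_cat_code C = list_encode
    [set_encode (carrier (obj C)),
     \<one>\<^bsub>obj C\<^esub>,
     graph2_code {(x, y, x \<otimes>\<^bsub>obj C\<^esub> y) | x y. x \<in> carrier (obj C) \<and> y \<in> carrier (obj C)},
     set_encode (arrows C),
     graph1_code {(u, src C u) | u. u \<in> arrows C},
     graph1_code {(u, tgt C u) | u. u \<in> arrows C},
     set_encode (carrier (half C)),
     \<one>\<^bsub>half C\<^esub>,
     graph2_code {(c, d, c \<otimes>\<^bsub>half C\<^esub> d) | c d. c \<in> carrier (half C) \<and> d \<in> carrier (half C)},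
     graph1_code {(c, hend C c) | c. c \<in> carrier (half C)},
     graph2_code {(u, v, cmp C u v) | u v. u \<in> arrows C \<and> v \<in> arrows C \<and> tgt C u = src C v},
     graph1_code {(x, ident C x) | x. x \<in> carrier (obj C)},
     graph2_code {(c, u, hact C c u) | c u.
       c \<in> carrier (half C) \<and> u \<in> arrows C \<and> hend C c = src C u},
     graph2_code {(u, c, ains C u c) | u c. u \<in> arrows C \<and> c \<in> carrier (half C)}]"

end

theory Submission
  imports Defs
begin

text \<open>
  A division into a flat idempotent commutative algebra can be replaced by one into the free
  semilattice on the arrows and half-arrows: choose a point in each covering set and pull
  the covering sets back along the homomorphism sending each generator to its point. So it suffices
  to search for covering sets made of subsets of the finite set of generators; these form a number
  of bounded size, and the conditions on them are bounded arithmetic formulas in that number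
  and the code of the category.
\<close>

section \<open>Computable functions\<close>

text \<open>In a flat algebra composition, action, insertion and addition are all the same join, so
  the four closure conditions have one form. The pullback works because preimages of disjoint sets
  are disjoint, preimages under a homomorphism inherit closure, and a generator lies in the preimage
  of its own covering set; hence a certificate may demand that generator instead of mere
  nonemptiness. Only this direction needs a size bound: a certificate of any size yields a division
  into the natural numbers under \<open>or\<close>. The remaining work is computability, which rests
  on two facts. A binary digit set at place i of m forces i < m, so quantifiers over members of
  coded sets are bounded by the codes themselves. And a total function with a decidable graph is
  computable by minimization, so no algorithm for \<open>or\<close> or for decoding pairs has to be
  given.\<close>

text \<open>
  The predicate \<open>recursive\<close> constrains a function also at lists of the wrong length; \<open>computable\<close>
  is its closure under extensional equality on lists of length \<open>n\<close>.
\<close>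

definition computable :: "nat \<Rightarrow> (nat list \<Rightarrow> nat) \<Rightarrow> bool" where
  "computable n f \<longleftrightarrow> (\<exists>g. recursive n g \<and> (\<forall>xs. length xs = n \<longrightarrow> f xs = g xs))"

definition computable_pred :: "nat \<Rightarrow> (nat list \<Rightarrow> bool) \<Rightarrow> bool" where
  "computable_pred n P \<longleftrightarrow> computable n (\<lambda>xs. if P xs then 1 else 0)"

lemma computable_cong:
  assumes "computable n f" "\<And>xs. length xs = n \<Longrightarrow> f xs = g xs"
  shows "computable n g"
  using assms by (auto simp: computable_def)

lemma recursive_computable: "recursive n f \<Longrightarrow> computable n f"
  by (auto simp: computable_def)

lemma computable_subst:
  assumes "computable (length fs) g" "\<forall>f\<in>set fs. computable n f"
  shows "computable n (\<lambda>xs. g (map (\<lambda>f. f xs) fs))"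
proof -
  obtain g' where g': "recursive (length fs) g'" "\<forall>xs. length xs = length fs \<longrightarrow> g xs = g' xs"
    using assms(1) by (auto simp: computable_def)
  obtain h where h: "\<forall>f\<in>set fs. recursive n (h f) \<and> (\<forall>xs. length xs = n \<longrightarrow> f xs = h f xs)"
    using assms(2) unfolding computable_def by metis
  have "recursive n (\<lambda>xs. g' (map (\<lambda>f. f xs) (map h fs)))"
    by (rule recursive.subst) (use g'(1) h in auto)
  moreover have "g (map (\<lambda>f. f xs) fs) = g' (map (\<lambda>f. f xs) (map h fs))" if "length xs = n" for xs
    using g'(2) h that by (simp add: comp_def cong: map_cong)
  ultimately show ?thesis by (auto simp: computable_def)
qed

section \<open>Variables as positions in the argument list\<close>

lemma computable_nth: "i < n \<Longrightarrow> computable n (\<lambda>xs. xs ! i)"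
  by (intro recursive_computable recursive.proj)

lemma computable_hd: "computable (Suc n) hd"
  by (rule computable_cong[OF computable_nth[of 0]]) (auto simp: length_Suc_conv)

text \<open>Weakening: a new variable is pushed to the front of the argument list, so the older
  context is \<open>tl xs\<close>.\<close>

lemma computable_tl:
  assumes "computable n f"
  shows "computable (Suc n) (\<lambda>xs. f (tl xs))"
proof (rule computable_cong)
  let ?fs = "map (\<lambda>i xs. xs ! Suc i) [0..<n] :: (nat list \<Rightarrow> nat) list"
  show "computable (Suc n) (\<lambda>xs. f (map (\<lambda>f. f xs) ?fs))"
    by (rule computable_subst) (use assms in \<open>auto intro!: computable_nth\<close>)
  fix xs :: "nat list" assume "length xs = Suc n"
  then have "map (\<lambda>f. f xs) ?fs = tl xs"
    by (auto simp: comp_def nth_tl intro!: nth_equalityI)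
  then show "f (map (\<lambda>f. f xs) ?fs) = f (tl xs)" by (rule arg_cong)
qed

text \<open>Substitution for the front variable, the counterpart of
  \<open>computable_tl\<close>.\<close>

lemma computable_Cons:
  assumes "computable (Suc n) g" "computable n a"
  shows "computable n (\<lambda>xs. g (a xs # xs))"
proof (rule computable_cong)
  let ?fs = "a # map (\<lambda>i xs. xs ! i) [0..<n] :: (nat list \<Rightarrow> nat) list"
  show "computable n (\<lambda>xs. g (map (\<lambda>f. f xs) ?fs))"
    by (rule computable_subst) (use assms in \<open>auto intro!: computable_nth\<close>)
  fix xs :: "nat list" assume "length xs = n"
  then have "map (\<lambda>f. f xs) ?fs = a xs # xs"
    by (auto simp: comp_def intro!: nth_equalityI)
  then show "g (map (\<lambda>f. f xs) ?fs) = g (a xs # xs)" by (rule arg_cong)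
qed

section \<open>Arithmetic\<close>

lemma computable_Suc:
  assumes "computable n f"
  shows "computable n (\<lambda>xs. Suc (f xs))"
  using computable_subst[of "[f]" "\<lambda>xs. Suc (xs ! 0)" n] recursive_computable[OF recursive.succ] assms
  by simp

lemma computable_const: "computable n (\<lambda>xs. k)"
  by (induction k) (auto intro: computable_Suc recursive_computable recursive.zero)

text \<open>The scheme \<open>prim_rec\<close> takes the number of steps from the head of the list;
  recursion over a fresh head is followed by substituting \<open>m\<close> for it. Counter and
  accumulator are the two front variables of the step function.\<close>

lemma computable_rec_nat:
  assumes "computable n a" "computable (Suc (Suc n)) (\<lambda>ys. g (hd ys) (hd (tl ys)) (tl (tl ys)))"
    and "computable n m"
  shows "computable n (\<lambda>xs. rec_nat (a xs) (\<lambda>k r. g k r xs) (m xs))"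
proof -
  obtain a' where a': "recursive n a'" "\<forall>xs. length xs = n \<longrightarrow> a xs = a' xs"
    using assms(1) by (auto simp: computable_def)
  obtain g' where g': "recursive (Suc (Suc n)) g'"
    "\<forall>ys. length ys = Suc (Suc n) \<longrightarrow> g (hd ys) (hd (tl ys)) (tl (tl ys)) = g' ys"
    using assms(2) by (auto simp: computable_def)
  have "computable (Suc n) (\<lambda>xs. rec_nat (a (tl xs)) (\<lambda>k r. g k r (tl xs)) (hd xs))"
  proof (rule computable_cong[OF recursive_computable[OF recursive.prim_rec[OF a'(1) g'(1)]]])
    fix xs :: "nat list" assume "length xs = Suc n"
    moreover have "g k r zs = g' (k # r # zs)" if "length zs = n" for k r zs
      using g'(2)[rule_format, of "k # r # zs"] that by simp
    ultimately show "rec_nat (a' (tl xs)) (\<lambda>k r. g' (k # r # tl xs)) (hd xs)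
      = rec_nat (a (tl xs)) (\<lambda>k r. g k r (tl xs)) (hd xs)"
      using a'(2) by simp
  qed
  from computable_Cons[OF this assms(3)] show ?thesis by simp
qed

lemma computable_add:
  assumes "computable n a" "computable n b"
  shows "computable n (\<lambda>xs. a xs + b xs)"
proof -
  have "rec_nat x (\<lambda>k r. Suc r) y = x + y" for x y by (induction y) auto
  with computable_rec_nat[OF assms(1) _ assms(2), of "\<lambda>k r xs. Suc r"] show ?thesis
    by (simp add: computable_Suc computable_tl computable_hd)
qed

lemma computable_mult:
  assumes "computable n a" "computable n b"
  shows "computable n (\<lambda>xs. a xs * b xs)"
proof -
  have "rec_nat 0 (\<lambda>k r. r + x) y = x * y" for x y :: nat by (induction y) auto
  moreover have "computable (Suc (Suc n)) (\<lambda>ys. hd (tl ys) + a (tl (tl ys)))"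
    by (intro computable_add computable_tl[of _ hd] computable_hd
        computable_tl[of _ "\<lambda>ys. a (tl ys)"] computable_tl[of _ a] assms)
  ultimately show ?thesis
    using computable_rec_nat[OF computable_const _ assms(2), of "\<lambda>k r xs. r + a xs" 0] by simp
qed

lemma computable_power:
  assumes "computable n b"
  shows "computable n (\<lambda>xs. k ^ b xs)"
proof -
  have "rec_nat 1 (\<lambda>i r. k * r) y = k ^ y" for y by (induction y) auto
  with computable_rec_nat[OF computable_const _ assms, of "\<lambda>i r xs. k * r" 1] show ?thesis
    by (simp add: computable_mult computable_const computable_tl computable_hd)
qed

lemma computable_triangle:
  assumes "computable n b"
  shows "computable n (\<lambda>xs. triangle (b xs))"
proof -
  have "rec_nat 0 (\<lambda>i r. r + Suc i) y = triangle y" for y by (induction y) auto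
  with computable_rec_nat[OF computable_const _ assms, of "\<lambda>i r xs. r + Suc i" 0] show ?thesis
    by (simp add: computable_add computable_Suc computable_tl computable_hd del: add_Suc_right)
qed

lemma computable_pred_nat:
  assumes "computable n b"
  shows "computable n (\<lambda>xs. b xs - 1)"
proof -
  have "rec_nat 0 (\<lambda>i r. i) y = y - 1" for y by (cases y) auto
  with computable_rec_nat[OF computable_const _ assms, of "\<lambda>i r xs. i" 0] show ?thesis
    by (simp add: computable_hd)
qed

lemma computable_diff:
  assumes "computable n a" "computable n b"
  shows "computable n (\<lambda>xs. a xs - b xs)"
proof -
  have "rec_nat x (\<lambda>k r. r - 1) y = x - y" for x y :: nat by (induction y) auto
  with computable_rec_nat[OF assms(1) _ assms(2), of "\<lambda>k r xs. r - 1"] show ?thesis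
    using computable_pred_nat[of "Suc (Suc n)" "\<lambda>ys. hd (tl ys)"]
    by (simp add: computable_tl computable_hd)
qed

lemma computable_prod_encode:
  assumes "computable n a" "computable n b"
  shows "computable n (\<lambda>xs. prod_encode (a xs, b xs))"
  using assms by (simp add: prod_encode_def computable_add computable_triangle)

section \<open>Truth values and connectives\<close>

lemma computable_pred_le:
  assumes "computable n a" "computable n b"
  shows "computable_pred n (\<lambda>xs. a xs \<le> b xs)"
proof -
  have "computable n (\<lambda>xs. 1 - (a xs - b xs))"
    by (intro computable_diff computable_const assms)
  moreover have "1 - (x - y) = (if x \<le> y then 1 else 0)" for x y :: nat by auto
  ultimately show ?thesis by (simp add: computable_pred_def)
qed

lemma computable_pred_not:
  assumes "computable_pred n P"
  shows "computable_pred n (\<lambda>xs. \<not> P xs)"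
proof -
  have "computable n (\<lambda>xs. 1 - (if P xs then 1 else 0))"
    using assms by (intro computable_diff computable_const) (simp add: computable_pred_def)
  then show ?thesis unfolding computable_pred_def by (rule computable_cong) auto
qed

lemma computable_pred_conj:
  assumes "computable_pred n P" "computable_pred n Q"
  shows "computable_pred n (\<lambda>xs. P xs \<and> Q xs)"
proof -
  have "computable n (\<lambda>xs. (if P xs then 1 else 0) * (if Q xs then 1 else 0))"
    using assms by (intro computable_mult) (simp_all add: computable_pred_def)
  then show ?thesis unfolding computable_pred_def by (rule computable_cong) auto
qed

lemma computable_pred_disj:
  assumes "computable_pred n P" "computable_pred n Q"
  shows "computable_pred n (\<lambda>xs. P xs \<or> Q xs)"
  using computable_pred_not[OF computable_pred_conj[OF assms[THEN computable_pred_not]]] by simp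

lemma computable_pred_imp:
  assumes "computable_pred n P" "computable_pred n Q"
  shows "computable_pred n (\<lambda>xs. P xs \<longrightarrow> Q xs)"
  using computable_pred_disj[OF computable_pred_not[OF assms(1)] assms(2)] by (simp only: imp_conv_disj)

text \<open>De Bruijn access to variables. With \<open>hd\<close> and \<open>drop\<close> in place
  of \<open>!\<close>, the shift \<open>arg_tl\<close> holds without a side condition on the length,
  so the simplifier can use it under quantifiers.\<close>

definition arg :: "nat \<Rightarrow> nat list \<Rightarrow> nat" where
  "arg i xs = hd (drop i xs)"

lemma arg_tl: "arg i (tl xs) = arg (Suc i) xs"
  by (simp add: arg_def drop_Suc)

lemma arg_Cons: "arg 0 (x # xs) = x" "arg (Suc i) (x # xs) = arg i xs"
  by (simp_all add: arg_def)

lemma computable_arg: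
  assumes "i < n"
  shows "computable n (\<lambda>xs. arg i xs)"
  by (rule computable_cong[OF computable_nth[OF assms]]) (use assms in \<open>simp add: arg_def hd_drop_conv_nth\<close>)

lemma computable_subst1:
  assumes "computable 1 (\<lambda>xs. g (arg 0 xs))" "computable n a"
  shows "computable n (\<lambda>xs. g (a xs))"
proof -
  have "computable n (\<lambda>xs. (\<lambda>ys. g (arg 0 ys)) (map (\<lambda>f. f xs) [a]))"
    by (rule computable_subst[where fs = "[a]" and g = "\<lambda>ys. g (arg 0 ys)"]) (use assms in simp_all)
  then show ?thesis by (simp only: list.map arg_Cons)
qed

lemma computable_subst2:
  assumes "computable 2 (\<lambda>xs. g (arg 0 xs) (arg 1 xs))" "computable n a" "computable n b"
  shows "computable n (\<lambda>xs. g (a xs) (b xs))"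
proof -
  have "computable n (\<lambda>xs. (\<lambda>ys. g (arg 0 ys) (arg 1 ys)) (map (\<lambda>f. f xs) [a, b]))"
    by (rule computable_subst[where fs = "[a, b]" and g = "\<lambda>ys. g (arg 0 ys) (arg 1 ys)"])
      (use assms in \<open>simp_all add: numeral_2_eq_2\<close>)
  then show ?thesis by (simp only: list.map arg_Cons One_nat_def)
qed

lemma computable_pred_subst:
  assumes "computable_pred (length fs) P" "\<forall>f\<in>set fs. computable n f"
  shows "computable_pred n (\<lambda>xs. P (map (\<lambda>f. f xs) fs))"
  unfolding computable_pred_def
  by (rule computable_subst[where g = "\<lambda>xs. if P xs then 1 else 0"])
    (use assms in \<open>simp_all only: computable_pred_def\<close>)

lemma computable_pred_subst2:
  assumes "computable_pred 2 (\<lambda>xs. P (arg 0 xs) (arg 1 xs))" "computable n a" "computable n b"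
  shows "computable_pred n (\<lambda>xs. P (a xs) (b xs))"
  using assms unfolding computable_pred_def
  by (rule computable_subst2[where g = "\<lambda>x y. if P x y then 1 else 0"])

lemma computable_pred_cong:
  assumes "computable_pred n P" "\<And>xs. length xs = n \<Longrightarrow> P xs \<longleftrightarrow> Q xs"
  shows "computable_pred n Q"
  using assms(1) unfolding computable_pred_def
  by (rule computable_cong[where f = "\<lambda>xs. if P xs then 1 else 0"]) (simp add: assms(2))

lemma computable_pred_iff:
  assumes "computable_pred n P" "computable_pred n Q"
  shows "computable_pred n (\<lambda>xs. P xs \<longleftrightarrow> Q xs)"
  by (rule computable_pred_cong[OF computable_pred_conj[OF
      computable_pred_imp[OF assms] computable_pred_imp[OF assms(2,1)]]]) auto

lemma computable_pred_eq:
  assumes "computable n a" "computable n b"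
  shows "computable_pred n (\<lambda>xs. a xs = b xs)"
  by (rule computable_pred_cong[OF computable_pred_conj[OF
      computable_pred_le[OF assms] computable_pred_le[OF assms(2,1)]]]) auto

text \<open>The truth value is the product of the truth values of the instances, accumulated by
  primitive recursion.\<close>

lemma computable_pred_bounded_all:
  assumes "computable_pred (Suc n) (\<lambda>ys. P (arg 0 ys) (tl ys))" "computable n b"
  shows "computable_pred n (\<lambda>xs. \<forall>i\<le>b xs. P i xs)"
proof -
  let ?g = "\<lambda>i r xs. r * (if P i xs then 1 else 0 :: nat)"
  define Q where "Q = (\<lambda>ys. if P (arg 0 ys) (tl ys) then 1 else 0 :: nat)"
  \<comment> \<open>The accumulator stands second in the list, and \<open>P\<close> must not see
    it.\<close>
  have "computable (Suc (Suc n)) (\<lambda>ys. Q (arg 0 ys # tl (tl ys)))"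
  proof (rule computable_cong)
    let ?fs = "(\<lambda>ys. arg 0 ys) # map (\<lambda>i ys. arg (Suc (Suc i)) ys) [0..<n]"
    show "computable (Suc (Suc n)) (\<lambda>ys. Q (map (\<lambda>f. f ys) ?fs))"
      by (rule computable_subst) (use assms in \<open>auto simp: computable_pred_def Q_def intro!: computable_arg\<close>)
    fix ys :: "nat list" assume "length ys = Suc (Suc n)"
    then have "map (\<lambda>f. f ys) ?fs = arg 0 ys # tl (tl ys)"
      by (auto simp: comp_def arg_def length_Suc_conv hd_drop_conv_nth intro!: nth_equalityI)
    then show "Q (map (\<lambda>f. f ys) ?fs) = Q (arg 0 ys # tl (tl ys))" by (rule arg_cong)
  qed
  then have "computable (Suc (Suc n)) (\<lambda>ys. if P (arg 0 ys) (tl (tl ys)) then 1 else 0)"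
    by (simp add: Q_def arg_Cons)
  then have "computable (Suc (Suc n)) (\<lambda>ys. ?g (hd ys) (hd (tl ys)) (tl (tl ys)))"
    by (intro computable_mult) (simp_all add: arg_def computable_tl computable_hd)
  \<comment> \<open>After m steps the product covers the indices below m, hence one step more than
    the bound.\<close>
  then have "computable n (\<lambda>xs. rec_nat 1 (\<lambda>i r. ?g i r xs) (Suc (b xs)))"
    by (rule computable_rec_nat[where a = "\<lambda>xs. 1" and g = ?g and m = "\<lambda>xs. Suc (b xs)", OF computable_const])
      (intro computable_Suc assms(2))
  moreover have "rec_nat 1 (\<lambda>i r. ?g i r xs) m = (if \<forall>i<m. P i xs then 1 else 0)" for xs m
    by (induction m) (auto simp: less_Suc_eq)
  ultimately show ?thesis
    by (simp add: computable_pred_def less_Suc_eq_le del: old.nat.simps)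
qed

lemma computable_pred_bounded_ex:
  assumes "computable_pred (Suc n) (\<lambda>ys. P (arg 0 ys) (tl ys))" "computable n b"
  shows "computable_pred n (\<lambda>xs. \<exists>i\<le>b xs. P i xs)"
  using computable_pred_not[OF computable_pred_bounded_all[OF computable_pred_not[OF assms(1)] assms(2)]]
  by simp

lemma computable_pred_all:
  assumes "computable_pred (Suc n) (\<lambda>ys. P (arg 0 ys) (tl ys))" "computable n b"
    and "\<And>xs i. \<not> P i xs \<Longrightarrow> i \<le> b xs"
  shows "computable_pred n (\<lambda>xs. \<forall>i. P i xs)"
  by (rule computable_pred_cong[OF computable_pred_bounded_all[OF assms(1,2)]]) (use assms(3) in blast)

text \<open>The value is the only zero of the characteristic function of the negated graph, so
  minimization finds it; totality of \<open>f\<close> makes the minimization regular.\<close>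

lemma computable_graph:
  assumes "computable_pred (Suc n) (\<lambda>ys. arg 0 ys = f (tl ys))"
  shows "computable n f"
proof -
  have "computable (Suc n) (\<lambda>ys. if arg 0 ys \<noteq> f (tl ys) then 1 else 0)"
    using computable_pred_not[OF assms] by (simp add: computable_pred_def)
  then obtain g where g: "recursive (Suc n) g"
    "\<forall>ys. length ys = Suc n \<longrightarrow> (if arg 0 ys \<noteq> f (tl ys) then 1 else 0) = g ys"
    unfolding computable_def by blast
  have zero: "g (k # xs) = 0 \<longleftrightarrow> k = f xs" if "length xs = n" for k xs
    using g(2)[rule_format, of "k # xs"] that by (auto simp: arg_Cons split: if_splits)
  have "recursive n (\<lambda>xs. LEAST k. g (k # xs) = 0)"
    by (rule recursive.minimize[OF g(1)]) (simp add: zero)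
  then show ?thesis
    by (rule computable_cong[OF recursive_computable]) (simp add: zero Least_equality)
qed

lemmas computable_intros =
  computable_arg computable_const computable_add computable_mult computable_power
  computable_prod_encode computable_Suc computable_pred_le computable_pred_eq
  computable_pred_not computable_pred_conj computable_pred_disj computable_pred_imp
  computable_pred_iff

text \<open>A digit is set exactly when the quotient by the corresponding power of 2 is odd. Writing
  the quotient as 2q + 1 and the remainder as s, both q and s are at most the number itself.\<close>

lemma computable_pred_bit:
  assumes "computable n a" "computable n b"
  shows "computable_pred n (\<lambda>xs. bit (a xs) (b xs))"
proof -
  have "computable_pred 2 (\<lambda>xs. \<exists>q\<le>arg 0 xs. \<exists>s\<le>arg 0 xs.
    arg 0 xs = (2 * q + 1) * 2 ^ arg 1 xs + s \<and> Suc s \<le> 2 ^ arg 1 xs)"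
    by (intro computable_pred_bounded_ex computable_intros; simp add: arg_tl computable_arg)
  moreover have "(\<exists>q\<le>x. \<exists>s\<le>x. x = (2 * q + 1) * 2 ^ i + s \<and> Suc s \<le> 2 ^ i) \<longleftrightarrow> bit x i" for x i :: nat
  proof
    assume "bit x i"
    then obtain q where q: "x div 2 ^ i = 2 * q + 1"
      by (auto simp: bit_iff_odd elim: oddE)
    then have x: "x = (2 * q + 1) * 2 ^ i + x mod 2 ^ i"
      using div_mult_mod_eq[of x "2 ^ i"] by simp
    moreover have "q \<le> x" using q div_le_dividend[of x "2 ^ i"] by linarith
    ultimately show "\<exists>q\<le>x. \<exists>s\<le>x. x = (2 * q + 1) * 2 ^ i + s \<and> Suc s \<le> 2 ^ i"
      by (intro exI[of _ q] exI[of _ "x mod 2 ^ i"] conjI) (simp_all add: Suc_le_eq)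
  next
    assume "\<exists>q\<le>x. \<exists>s\<le>x. x = (2 * q + 1) * 2 ^ i + s \<and> Suc s \<le> 2 ^ i"
    then obtain q s where "x = (2 * q + 1) * 2 ^ i + s" "s < 2 ^ i" by (auto simp: Suc_le_eq)
    then have "x div 2 ^ i = 2 * q + 1" by (simp only: div_mult_self3) simp
    then show "bit x i" by (simp add: bit_iff_odd)
  qed
  ultimately have "computable_pred 2 (\<lambda>xs. bit (arg 0 xs) (arg 1 xs))" by simp
  then show ?thesis using assms by (rule computable_pred_subst2)
qed

lemma bit_less:
  fixes m :: nat
  assumes "bit m i"
  shows "i < m"
proof (rule ccontr)
  assume "\<not> i < m"
  then have "m < 2 ^ i" using less_exp[of i] by linarith
  with assms show False by (simp add: bit_iff_odd)
qed

lemma computable_or: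
  assumes "computable n a" "computable n b"
  shows "computable n (\<lambda>xs. or (a xs) (b xs))"
proof -
  have "computable_pred 3 (\<lambda>xs. \<forall>i. bit (arg 0 xs) i \<longleftrightarrow> bit (arg 1 xs) i \<or> bit (arg 2 xs) i)"
  \<comment> \<open>A disagreement at place \<open>i\<close> means that at least one of the three
    numbers has this digit set, so their sum bounds \<open>i\<close>.\<close>
  proof (rule computable_pred_all[where b = "\<lambda>xs. arg 0 xs + arg 1 xs + arg 2 xs"])
    fix xs i
    assume "\<not> (bit (arg 0 xs) i \<longleftrightarrow> bit (arg 1 xs) i \<or> bit (arg 2 xs) i)"
    then show "i \<le> arg 0 xs + arg 1 xs + arg 2 xs" by (auto dest!: bit_less)
  qed (intro computable_intros computable_pred_bit; simp add: arg_tl computable_arg)+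
  moreover have "(\<forall>i. bit z i \<longleftrightarrow> bit x i \<or> bit y i) \<longleftrightarrow> z = or x y" for x y z :: nat
    by (auto simp: bit_eq_iff bit_simps)
  ultimately have "computable_pred (Suc 2) (\<lambda>ys. arg 0 ys = or (arg 0 (tl ys)) (arg 1 (tl ys)))"
    by (simp add: arg_tl numeral_2_eq_2 numeral_3_eq_3)
  from computable_subst2[OF computable_graph[OF this] assms] show ?thesis .
qed

text \<open>The graph of each projection is decided by searching for the other component, which is
  at most the code of the pair.\<close>

lemma computable_prod_decode:
  assumes "computable n a"
  shows "computable n (\<lambda>xs. fst (prod_decode (a xs)))" "computable n (\<lambda>xs. snd (prod_decode (a xs)))"
proof -
  have "computable_pred 2 (\<lambda>xs. \<exists>y\<le>arg 1 xs. arg 1 xs = prod_encode (arg 0 xs, y))"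
    by (intro computable_pred_bounded_ex computable_intros; simp add: arg_tl computable_arg)
  moreover have "(\<exists>y\<le>m. m = prod_encode (x, y)) \<longleftrightarrow> x = fst (prod_decode m)" for m x
    by (metis le_prod_encode_2 fst_conv prod.collapse prod_decode_inverse prod_encode_inverse)
  ultimately have "computable_pred (Suc 1) (\<lambda>ys. arg 0 ys = fst (prod_decode (arg 0 (tl ys))))"
    by (simp add: arg_tl numeral_2_eq_2)
  from computable_subst1[OF computable_graph[OF this] assms]
  show "computable n (\<lambda>xs. fst (prod_decode (a xs)))" .
  have "computable_pred 2 (\<lambda>xs. \<exists>y\<le>arg 1 xs. arg 1 xs = prod_encode (y, arg 0 xs))"
    by (intro computable_pred_bounded_ex computable_intros; simp add: arg_tl computable_arg)
  moreover have "(\<exists>y\<le>m. m = prod_encode (y, x)) \<longleftrightarrow> x = snd (prod_decode m)" for m x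
    by (metis le_prod_encode_1 snd_conv prod.collapse prod_decode_inverse prod_encode_inverse)
  ultimately have "computable_pred (Suc 1) (\<lambda>ys. arg 0 ys = snd (prod_decode (arg 0 (tl ys))))"
    by (simp add: arg_tl numeral_2_eq_2)
  from computable_subst1[OF computable_graph[OF this] assms]
  show "computable n (\<lambda>xs. snd (prod_decode (a xs)))" .
qed

text \<open>Component access for \<open>list_encode\<close>: subtracting 1 undoes the
  \<open>Suc\<close> that separates nonempty lists from the empty one.\<close>

fun entry :: "nat \<Rightarrow> nat \<Rightarrow> nat" where
  "entry 0 m = fst (prod_decode (m - 1))"
| "entry (Suc k) m = entry k (snd (prod_decode (m - 1)))"

lemma entry_list_encode: "k < length xs \<Longrightarrow> entry k (list_encode xs) = xs ! k"
  by (induction xs arbitrary: k) (auto simp: less_Suc_eq_0_disj)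

lemma entry_le: "entry k m \<le> m"
proof (induction k m rule: entry.induct)
  case (1 m)
  then show ?case
    by (metis entry.simps(1) diff_le_self le_prod_encode_1 le_trans prod.collapse prod_decode_inverse)
next
  case (2 k m)
  then show ?case
    by (metis entry.simps(2) diff_le_self le_prod_encode_2 le_trans prod.collapse prod_decode_inverse)
qed

lemma computable_entry: "computable n a \<Longrightarrow> computable n (\<lambda>xs. entry k (a xs))"
  by (induction k arbitrary: a)
    (simp_all add: computable_prod_decode computable_pred_nat del: One_nat_def)

section \<open>Certificates\<close>

text \<open>
  A set of generators is a number read in binary, its union with another one is \<open>or\<close>, and
  the generators are the numbers \<open>2 * u\<close> for arrows \<open>u\<close> and \<open>2 * c + 1\<close> for half-arrows \<open>c\<close>.
  The number \<open>r\<close> is the set of pairs \<open>(x, e)\<close> with \<open>x\<close> in the covering set of \<open>e\<close>.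
  Among the arguments, \<open>i\<close>, \<open>j\<close>, \<open>k\<close> are \<open>0\<close> for arrows and \<open>1\<close> for half-arrows.
\<close>

definition contains_generators :: "nat \<Rightarrow> nat \<Rightarrow> nat \<Rightarrow> bool" where
  "contains_generators r D i \<longleftrightarrow>
     (\<forall>u. bit D u \<longrightarrow> bit r (prod_encode (2 ^ (2 * u + i), 2 * u + i)))"

definition closed_under :: "nat \<Rightarrow> nat \<Rightarrow> nat \<Rightarrow> nat \<Rightarrow> nat \<Rightarrow> bool" where
  "closed_under r G i j k \<longleftrightarrow>
     (\<forall>x y u v w. bit G (prod_encode (u, prod_encode (v, w))) \<longrightarrow>
        bit r (prod_encode (x, 2 * u + i)) \<longrightarrow> bit r (prod_encode (y, 2 * v + j)) \<longrightarrow>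
        bit r (prod_encode (or x y, 2 * w + k)))"

text \<open>\<open>F\<close> and \<open>G\<close> are graphs of maps on \<open>D\<close>. Equal
  values are expressed by equal rows of the graph, which avoids evaluating the maps.\<close>

definition separates :: "nat \<Rightarrow> nat \<Rightarrow> nat \<Rightarrow> nat \<Rightarrow> nat \<Rightarrow> bool" where
  "separates r D F G i \<longleftrightarrow>
     (\<forall>x u v. bit D u \<longrightarrow> bit D v \<longrightarrow>
        (\<forall>s. bit F (prod_encode (u, s)) \<longleftrightarrow> bit F (prod_encode (v, s))) \<longrightarrow>
        (\<forall>s. bit G (prod_encode (u, s)) \<longleftrightarrow> bit G (prod_encode (v, s))) \<longrightarrow>
        bit r (prod_encode (x, 2 * u + i)) \<longrightarrow> bit r (prod_encode (x, 2 * v + i)) \<longrightarrow> u = v)"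

text \<open>The indices are positions in \<open>forest_cat_code\<close>: 3 and 6 are the arrows and
  half-arrows, 8, 10, 12, 13 the graphs of addition, composition, action and insertion, 4 and 5
  source and target. Half-arrows have only the end map, at 9, so it fills both places.\<close>

definition certificate :: "nat \<Rightarrow> nat \<Rightarrow> bool" where
  "certificate r m \<longleftrightarrow>
     contains_generators r (entry 3 m) 0 \<and> contains_generators r (entry 6 m) 1 \<and>
     closed_under r (entry 8 m) 1 1 1 \<and> closed_under r (entry 10 m) 0 0 0 \<and>
     closed_under r (entry 12 m) 1 0 1 \<and> closed_under r (entry 13 m) 0 1 0 \<and>
     separates r (entry 3 m) (entry 4 m) (entry 5 m) 0 \<and>
     separates r (entry 6 m) (entry 9 m) (entry 9 m) 1"

lemma bit_prod_encode_le:
  assumes "bit m (prod_encode (a, b))"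
  shows "a \<le> m" "b \<le> m"
  using bit_less[OF assms] le_prod_encode_1[of a b] le_prod_encode_2[of b a] by linarith+

lemma computable_pred_contains_generators:
  assumes "computable n r" "computable n D"
  shows "computable_pred n (\<lambda>xs. contains_generators (r xs) (D xs) i)"
proof (rule computable_pred_subst2[OF _ assms])
  show "computable_pred 2 (\<lambda>xs. contains_generators (arg 0 xs) (arg 1 xs) i)"
    unfolding contains_generators_def
  proof (rule computable_pred_all[where b = "\<lambda>xs. arg 1 xs"])
    fix xs u
    assume "\<not> (bit (arg 1 xs) u \<longrightarrow> bit (arg 0 xs) (prod_encode (2 ^ (2 * u + i), 2 * u + i)))"
    then show "u \<le> arg 1 xs" by (auto dest: bit_less)
  qed (intro computable_intros computable_pred_bit; simp add: arg_tl computable_arg)+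
qed

text \<open>A pair that belongs to a coded set has components below the code: this bounds
  \<open>x\<close> and \<open>y\<close> by \<open>r\<close>, and \<open>u\<close>, \<open>v\<close>,
  \<open>w\<close> by \<open>G\<close>.\<close>

lemma computable_pred_closed_under:
  assumes "computable n r" "computable n G"
  shows "computable_pred n (\<lambda>xs. closed_under (r xs) (G xs) i j k)"
proof (rule computable_pred_subst2[OF _ assms])
  have "computable_pred 2 (\<lambda>xs. \<forall>x\<le>arg 0 xs. \<forall>y\<le>arg 0 xs. \<forall>u\<le>arg 1 xs. \<forall>v\<le>arg 1 xs. \<forall>w\<le>arg 1 xs.
     bit (arg 1 xs) (prod_encode (u, prod_encode (v, w))) \<longrightarrow>
        bit (arg 0 xs) (prod_encode (x, 2 * u + i)) \<longrightarrow> bit (arg 0 xs) (prod_encode (y, 2 * v + j)) \<longrightarrow>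
        bit (arg 0 xs) (prod_encode (or x y, 2 * w + k)))"
    by (intro computable_pred_bounded_all computable_intros computable_pred_bit computable_or;
        simp add: arg_tl computable_arg)
  then show "computable_pred 2 (\<lambda>xs. closed_under (arg 0 xs) (arg 1 xs) i j k)"
    by (rule computable_pred_cong)
      (use bit_prod_encode_le le_prod_encode_1 le_prod_encode_2 le_trans in \<open>unfold closed_under_def, meson\<close>)
qed

lemma computable_pred_separates:
  assumes "computable n r" "computable n D" "computable n F" "computable n G"
  shows "computable_pred n (\<lambda>xs. separates (r xs) (D xs) (F xs) (G xs) i)"
proof -
  have "computable_pred 4 (\<lambda>xs. \<forall>x\<le>arg 0 xs. \<forall>u\<le>arg 1 xs. \<forall>v\<le>arg 1 xs.
     bit (arg 1 xs) u \<longrightarrow> bit (arg 1 xs) v \<longrightarrow>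
        (\<forall>s\<le>arg 2 xs. bit (arg 2 xs) (prod_encode (u, s)) \<longleftrightarrow> bit (arg 2 xs) (prod_encode (v, s))) \<longrightarrow>
        (\<forall>s\<le>arg 3 xs. bit (arg 3 xs) (prod_encode (u, s)) \<longleftrightarrow> bit (arg 3 xs) (prod_encode (v, s))) \<longrightarrow>
        bit (arg 0 xs) (prod_encode (x, 2 * u + i)) \<longrightarrow> bit (arg 0 xs) (prod_encode (x, 2 * v + i)) \<longrightarrow> u = v)"
    by (intro computable_pred_bounded_all computable_intros computable_pred_bit;
        simp add: arg_tl computable_arg)
  then have "computable_pred 4 (\<lambda>xs. separates (arg 0 xs) (arg 1 xs) (arg 2 xs) (arg 3 xs) i)"
  proof (rule computable_pred_cong)
    fix xs
    \<comment> \<open>For \<open>s\<close> beyond \<open>f\<close> both digits are 0.\<close>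
    have *: "(\<forall>s\<le>f. bit f (prod_encode (u, s)) \<longleftrightarrow> bit f (prod_encode (v, s))) \<longleftrightarrow>
      (\<forall>s. bit f (prod_encode (u, s)) \<longleftrightarrow> bit f (prod_encode (v, s)))" for f u v
      using bit_prod_encode_le by blast
    show "(\<forall>x\<le>arg 0 xs. \<forall>u\<le>arg 1 xs. \<forall>v\<le>arg 1 xs.
     bit (arg 1 xs) u \<longrightarrow> bit (arg 1 xs) v \<longrightarrow>
        (\<forall>s\<le>arg 2 xs. bit (arg 2 xs) (prod_encode (u, s)) \<longleftrightarrow> bit (arg 2 xs) (prod_encode (v, s))) \<longrightarrow>
        (\<forall>s\<le>arg 3 xs. bit (arg 3 xs) (prod_encode (u, s)) \<longleftrightarrow> bit (arg 3 xs) (prod_encode (v, s))) \<longrightarrow>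
        bit (arg 0 xs) (prod_encode (x, 2 * u + i)) \<longrightarrow> bit (arg 0 xs) (prod_encode (x, 2 * v + i)) \<longrightarrow> u = v)
      \<longleftrightarrow> separates (arg 0 xs) (arg 1 xs) (arg 2 xs) (arg 3 xs) i" (is "?bounded \<longleftrightarrow> ?separates")
    proof
      assume bounded: ?bounded
      show ?separates
        unfolding separates_def
      proof (intro allI impI)
        fix x u v
        assume h: "bit (arg 1 xs) u" "bit (arg 1 xs) v"
          "\<forall>s. bit (arg 2 xs) (prod_encode (u, s)) \<longleftrightarrow> bit (arg 2 xs) (prod_encode (v, s))"
          "\<forall>s. bit (arg 3 xs) (prod_encode (u, s)) \<longleftrightarrow> bit (arg 3 xs) (prod_encode (v, s))"
          "bit (arg 0 xs) (prod_encode (x, 2 * u + i))" "bit (arg 0 xs) (prod_encode (x, 2 * v + i))"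
        then have "x \<le> arg 0 xs" "u \<le> arg 1 xs" "v \<le> arg 1 xs"
          by (auto dest: bit_less bit_prod_encode_le)
        with bounded h show "u = v" by blast
      qed
    next
      assume ?separates
      then show ?bounded unfolding separates_def * by blast
    qed
  qed
  then show ?thesis
    using computable_pred_subst[where fs = "[r, D, F, G]"
        and P = "\<lambda>xs. separates (arg 0 xs) (arg 1 xs) (arg 2 xs) (arg 3 xs) i" and n = n] assms
    by (simp add: arg_Cons eval_nat_numeral)
qed

lemma computable_pred_certificate:
  assumes "computable n r" "computable n m"
  shows "computable_pred n (\<lambda>xs. certificate (r xs) (m xs))"
  unfolding certificate_def
  by (intro computable_pred_conj computable_pred_contains_generators computable_pred_closed_under
      computable_pred_separates computable_entry assms)

text \<open>If m is the code of the category, all generators lie below 2m + 2. Then sets of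
  generators are at most 2 to that power, \<open>prod_encode\<close> bounds the pairs of such a set
  and a generator, and the outer power bounds a set of such pairs.\<close>

definition certificate_bound :: "nat \<Rightarrow> nat" where
  "certificate_bound m = 2 ^ Suc (prod_encode (2 ^ (2 * m + 2), 2 * m + 2))"

text \<open>Returns from \<open>computable\<close> to \<open>recursive\<close>; the two agree on
  lists of length one, which is all that \<open>decidable_problem\<close> inspects.\<close>

lemma recursive_search:
  "\<exists>f. recursive 1 f \<and> (\<forall>m. f [m] = (if \<exists>r\<le>certificate_bound m. certificate r m then 1 else 0))"
proof -
  have "computable_pred 1 (\<lambda>xs. \<exists>r\<le>certificate_bound (arg 0 xs). certificate r (arg 0 xs))"
    unfolding certificate_bound_def
    by (intro computable_pred_bounded_ex computable_pred_certificate computable_intros;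
        simp add: arg_tl computable_arg)
  then obtain f where "recursive 1 f" and f: "\<And>xs. length xs = 1 \<Longrightarrow>
    (if \<exists>r\<le>certificate_bound (arg 0 xs). certificate r (arg 0 xs) then 1 else 0) = f xs"
    unfolding computable_pred_def computable_def by blast
  then show ?thesis using f[of "[m]" for m] by (intro exI[of _ f]) (simp add: arg_Cons)
qed

section \<open>Certificates and division\<close>

lemma bit_set_encode: "finite S \<Longrightarrow> bit (set_encode S) i \<longleftrightarrow> i \<in> S"
  using set_encode_inverse[of S] by (auto simp: set_decode_def bit_iff_odd)

lemma bit_graph1_code:
  assumes "finite R"
  shows "bit (graph1_code R) (prod_encode (x, y)) \<longleftrightarrow> (x, y) \<in> R"
proof -
  have "inj_on prod_encode (insert (x, y) R)" by (rule inj_prod_encode)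
  then show ?thesis using assms by (auto simp: graph1_code_def bit_set_encode inj_on_def)
qed

lemma bit_graph2_code:
  assumes "finite R"
  shows "bit (graph2_code R) (prod_encode (x, prod_encode (y, z))) \<longleftrightarrow> (x, y, z) \<in> R"
  using assms by (force simp: graph2_code_def bit_set_encode image_iff)

lemma set_encode_le_exp:
  assumes "S \<subseteq> {..<n}"
  shows "set_encode S \<le> 2 ^ n"
proof -
  have "set_encode S \<le> sum ((^) 2) {..<n}"
    unfolding set_encode_def by (rule sum_mono2) (use assms in auto)
  also have "\<dots> \<le> 2 ^ n"
    by (induction n) auto
  finally show ?thesis .
qed

lemma prod_encode_mono:
  assumes "a \<le> a'" "b \<le> b'"
  shows "prod_encode (a, b) \<le> prod_encode (a', b')"
proof -
  have "triangle m \<le> triangle n" if "m \<le> n" for m n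
    unfolding triangle_def by (intro div_le_mono mult_le_mono) (use that in simp_all)
  then show ?thesis using assms by (auto simp: prod_encode_def intro!: add_mono)
qed

context finite_forest_category
begin

lemma cmp_arrow: "\<lbrakk>u \<in> arrows C; v \<in> arrows C; tgt C u = src C v\<rbrakk> \<Longrightarrow> cmp C u v \<in> arrows C"
  using cmp_in[of u "src C u" "src C v" v "tgt C v"] by (simp add: Arr_def)

lemma hact_half:
  "\<lbrakk>c \<in> carrier (half C); u \<in> arrows C; hend C c = src C u\<rbrakk> \<Longrightarrow> hact C c u \<in> carrier (half C)"
  using hact_in[of c "src C u" u "tgt C u"] by (simp add: Arr_def HArr_def)

lemma ains_arrow: "\<lbrakk>u \<in> arrows C; c \<in> carrier (half C)\<rbrakk> \<Longrightarrow> ains C u c \<in> arrows C"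
  using ains_in[of u "src C u" "tgt C u" c "hend C c"] by (simp add: Arr_def HArr_def)

lemma half_closed:
  "\<lbrakk>c \<in> carrier (half C); d \<in> carrier (half C)\<rbrakk> \<Longrightarrow> c \<otimes>\<^bsub>half C\<^esub> d \<in> carrier (half C)"
  by (rule monoid.m_closed[OF comm_monoid.axioms(1)[OF half_monoid]])

text \<open>Eliminates the hom-sets in favour of source, target and end maps, the data that the code
  records, so that the clauses can be compared with those of a certificate.\<close>

lemma divides_flat_alg_iff:
  "divides C (flat_alg H) \<longleftrightarrow>
     (\<exists>K L. (\<forall>c\<in>carrier (half C). K c \<noteq> {} \<and> K c \<subseteq> carrier H) \<and>
        (\<forall>u\<in>arrows C. L u \<noteq> {} \<and> L u \<subseteq> carrier H) \<and>
        (\<forall>u\<in>arrows C. \<forall>v\<in>arrows C. tgt C u = src C v \<longrightarrow>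
           (\<forall>k\<in>L u. \<forall>l\<in>L v. k \<otimes>\<^bsub>H\<^esub> l \<in> L (cmp C u v))) \<and>
        (\<forall>c\<in>carrier (half C). \<forall>u\<in>arrows C. hend C c = src C u \<longrightarrow>
           (\<forall>k\<in>K c. \<forall>l\<in>L u. k \<otimes>\<^bsub>H\<^esub> l \<in> K (hact C c u))) \<and>
        (\<forall>c\<in>carrier (half C). \<forall>d\<in>carrier (half C). \<forall>k\<in>K c. \<forall>l\<in>K d.
           k \<otimes>\<^bsub>H\<^esub> l \<in> K (c \<otimes>\<^bsub>half C\<^esub> d)) \<and>
        (\<forall>u\<in>arrows C. \<forall>c\<in>carrier (half C). \<forall>k\<in>L u. \<forall>l\<in>K c.
           k \<otimes>\<^bsub>H\<^esub> l \<in> L (ains C u c)) \<and>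
        (\<forall>u\<in>arrows C. \<forall>v\<in>arrows C. src C u = src C v \<longrightarrow> tgt C u = tgt C v \<longrightarrow> u \<noteq> v \<longrightarrow>
           L u \<inter> L v = {}) \<and>
        (\<forall>c\<in>carrier (half C). \<forall>d\<in>carrier (half C). hend C c = hend C d \<longrightarrow> c \<noteq> d \<longrightarrow>
           K c \<inter> K d = {}))"
  unfolding divides_def flat_alg_def forest_alg.simps Arr_def HArr_def
  by (intro ex_cong1 conj_cong refl) (simp_all, (metis (no_types))+)

end

context
  fixes C :: "(nat, nat, nat) forest_cat"
  assumes C: "finite_forest_category C"
begin

interpretation finite_forest_category C by (fact C)

text \<open>Decoding the entries gives the clauses of division for the join \<open>or\<close>, with
  the covering sets read off \<open>r\<close> and nonemptiness sharpened to the presence of the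
  generator.\<close>

lemma certificate_forest_cat_code_iff:
  "certificate r (forest_cat_code C) \<longleftrightarrow>
     (\<forall>u\<in>arrows C. bit r (prod_encode (2 ^ (2 * u), 2 * u))) \<and>
     (\<forall>c\<in>carrier (half C). bit r (prod_encode (2 ^ (2 * c + 1), 2 * c + 1))) \<and>
     (\<forall>x y. \<forall>c\<in>carrier (half C). \<forall>d\<in>carrier (half C).
        bit r (prod_encode (x, 2 * c + 1)) \<longrightarrow> bit r (prod_encode (y, 2 * d + 1)) \<longrightarrow>
        bit r (prod_encode (or x y, 2 * (c \<otimes>\<^bsub>half C\<^esub> d) + 1))) \<and>
     (\<forall>x y. \<forall>u\<in>arrows C. \<forall>v\<in>arrows C. tgt C u = src C v \<longrightarrow>
        bit r (prod_encode (x, 2 * u)) \<longrightarrow> bit r (prod_encode (y, 2 * v)) \<longrightarrow>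
        bit r (prod_encode (or x y, 2 * cmp C u v))) \<and>
     (\<forall>x y. \<forall>c\<in>carrier (half C). \<forall>u\<in>arrows C. hend C c = src C u \<longrightarrow>
        bit r (prod_encode (x, 2 * c + 1)) \<longrightarrow> bit r (prod_encode (y, 2 * u)) \<longrightarrow>
        bit r (prod_encode (or x y, 2 * hact C c u + 1))) \<and>
     (\<forall>x y. \<forall>u\<in>arrows C. \<forall>c\<in>carrier (half C).
        bit r (prod_encode (x, 2 * u)) \<longrightarrow> bit r (prod_encode (y, 2 * c + 1)) \<longrightarrow>
        bit r (prod_encode (or x y, 2 * ains C u c))) \<and>
     (\<forall>x. \<forall>u\<in>arrows C. \<forall>v\<in>arrows C. src C u = src C v \<longrightarrow> tgt C u = tgt C v \<longrightarrow>
        bit r (prod_encode (x, 2 * u)) \<longrightarrow> bit r (prod_encode (x, 2 * v)) \<longrightarrow> u = v) \<and>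
     (\<forall>x. \<forall>c\<in>carrier (half C). \<forall>d\<in>carrier (half C). hend C c = hend C d \<longrightarrow>
        bit r (prod_encode (x, 2 * c + 1)) \<longrightarrow> bit r (prod_encode (x, 2 * d + 1)) \<longrightarrow> c = d)"
proof -
  let ?m = "forest_cat_code C" and ?A = "arrows C" and ?B = "carrier (half C)"
  have fin1: "finite {(u, f u) | u. u \<in> S}" if "finite S" for S :: "nat set" and f :: "nat \<Rightarrow> nat"
    using that by simp
  \<comment> \<open>\<open>P\<close> describes the domain of a partial operation. Finiteness is
    needed because \<open>set_encode\<close> is faithful only on finite sets.\<close>
  have fin2: "finite {(u, v, f u v) | u v. u \<in> S \<and> v \<in> T \<and> P u v}" if "finite S" "finite T"
    for S T :: "nat set" and f :: "nat \<Rightarrow> nat \<Rightarrow> nat" and P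
    by (rule finite_subset[of _ "(\<lambda>(u, v). (u, v, f u v)) ` (S \<times> T)"]) (use that in auto)
  note fin = fin2[OF finite_half finite_half, of _ "\<lambda>u v. True", simplified]
    fin2[OF finite_arrows finite_arrows] fin2[OF finite_half finite_arrows]
    fin2[OF finite_arrows finite_half, of _ "\<lambda>u v. True", simplified]
  have bits: "bit (entry 3 ?m) u \<longleftrightarrow> u \<in> ?A" "bit (entry 6 ?m) u \<longleftrightarrow> u \<in> ?B" for u
    by (simp_all add: forest_cat_code_def entry_list_encode bit_set_encode finite_arrows finite_half del: list_encode.simps)
  have bits1: "bit (entry 4 ?m) (prod_encode (u, s)) \<longleftrightarrow> u \<in> ?A \<and> s = src C u"
    "bit (entry 5 ?m) (prod_encode (u, s)) \<longleftrightarrow> u \<in> ?A \<and> s = tgt C u"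
    "bit (entry 9 ?m) (prod_encode (u, s)) \<longleftrightarrow> u \<in> ?B \<and> s = hend C u" for u s
    by (auto simp: forest_cat_code_def entry_list_encode bit_graph1_code fin1 finite_arrows finite_half simp del: list_encode.simps)
  have bits2: "bit (entry 8 ?m) (prod_encode (u, prod_encode (v, w))) \<longleftrightarrow>
      u \<in> ?B \<and> v \<in> ?B \<and> w = u \<otimes>\<^bsub>half C\<^esub> v"
    "bit (entry 10 ?m) (prod_encode (u, prod_encode (v, w))) \<longleftrightarrow>
      u \<in> ?A \<and> v \<in> ?A \<and> tgt C u = src C v \<and> w = cmp C u v"
    "bit (entry 12 ?m) (prod_encode (u, prod_encode (v, w))) \<longleftrightarrow>
      u \<in> ?B \<and> v \<in> ?A \<and> hend C u = src C v \<and> w = hact C u v"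
    "bit (entry 13 ?m) (prod_encode (u, prod_encode (v, w))) \<longleftrightarrow>
      u \<in> ?A \<and> v \<in> ?B \<and> w = ains C u v" for u v w
    by (auto simp: forest_cat_code_def entry_list_encode bit_graph2_code fin simp del: list_encode.simps)
  \<comment> \<open>Each row of a functional graph has one entry, so equal rows amount to equal
    values.\<close>
  have eq: "(\<forall>s. s = a \<longleftrightarrow> s = b) \<longleftrightarrow> a = b" for a b :: nat by blast
  show ?thesis
    unfolding certificate_def contains_generators_def closed_under_def separates_def add_0_right
      bits bits1 bits2
    by (intro arg_cong2[where f = "(\<and>)"];
        simp add: eq Ball_def imp_conjL cong: imp_cong; meson)
qed

text \<open>The natural numbers under \<open>or\<close> are the finite sets of natural numbers under
  union, an idempotent commutative monoid; the generators in \<open>r\<close> make the covering sets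
  nonempty.\<close>

lemma globally_idem_comm_if_certificate:
  assumes "certificate r (forest_cat_code C)"
  shows "globally_idem_comm C"
proof -
  let ?H = "\<lparr>carrier = UNIV, mult = or, one = 0\<rparr> :: nat monoid"
  let ?K = "\<lambda>c. {x. bit r (prod_encode (x, 2 * c + 1))}" and ?L = "\<lambda>u. {x. bit r (prod_encode (x, 2 * u))}"
  have "comm_monoid ?H"
    by (rule comm_monoidI) (simp_all add: or.assoc or.commute or.left_commute)
  then have "idem_comm_monoid ?H" by (simp add: idem_comm_monoid_def)
  moreover have "divides C (flat_alg ?H)"
    unfolding divides_flat_alg_iff
    by (rule exI[of _ ?K], rule exI[of _ ?L], insert assms[unfolded certificate_forest_cat_code_iff],
        elim conjE, intro conjI ballI impI)
      (auto simp del: add_Suc_right mult_Suc_right)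
  ultimately show ?thesis unfolding globally_idem_comm_def by blast
qed

text \<open>A member is smaller than the code of its set, and an entry is at most the code of the
  list. This feeds \<open>certificate_bound\<close>.\<close>

lemma element_le_forest_cat_code:
  "u \<in> arrows C \<Longrightarrow> u \<le> forest_cat_code C" "c \<in> carrier (half C) \<Longrightarrow> c \<le> forest_cat_code C"
proof -
  assume "u \<in> arrows C"
  then have "bit (entry 3 (forest_cat_code C)) u"
    by (simp add: forest_cat_code_def entry_list_encode bit_set_encode finite_arrows del: list_encode.simps)
  from bit_less[OF this] show "u \<le> forest_cat_code C" using entry_le[of 3 "forest_cat_code C"] by simp
next
  assume "c \<in> carrier (half C)"
  then have "bit (entry 6 (forest_cat_code C)) c"
    by (simp add: forest_cat_code_def entry_list_encode bit_set_encode finite_half del: list_encode.simps)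
  from bit_less[OF this] show "c \<le> forest_cat_code C" using entry_le[of 6 "forest_cat_code C"] by simp
qed

end

text \<open>The homomorphism property of the map from sets of generators to \<open>H\<close>. The
  two images may overlap, which idempotence absorbs.\<close>

lemma finprod_image_bit_or:
  fixes x y :: nat
  assumes "idem_comm_monoid H" "k ` {i. bit x i} \<subseteq> carrier H" "k ` {i. bit y i} \<subseteq> carrier H"
  shows "finprod H (\<lambda>h. h) (k ` {i. bit (or x y) i}) =
    finprod H (\<lambda>h. h) (k ` {i. bit x i}) \<otimes>\<^bsub>H\<^esub> finprod H (\<lambda>h. h) (k ` {i. bit y i})"
proof -
  have "finite {i. bit z i}" for z :: nat
    by (rule finite_subset[of _ "{..<z}"]) (auto dest: bit_less)
  moreover have "{i. bit (or x y) i} = {i. bit x i} \<union> {i. bit y i}"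
    by (auto simp: bit_simps)
  ultimately show ?thesis
    using finprod_idem_Un[OF assms(1), of "k ` {i. bit x i}" "k ` {i. bit y i}"] assms(2,3)
    by (simp add: image_Un)
qed

lemma certificate_if_globally_idem_comm:
  fixes C :: "(nat, nat, nat) forest_cat"
  assumes C: "finite_forest_category C" and gic: "globally_idem_comm C"
  shows "\<exists>r\<le>certificate_bound (forest_cat_code C). certificate r (forest_cat_code C)"
proof -
  interpret finite_forest_category C by (fact C)
  let ?m = "forest_cat_code C"
  obtain H :: "nat monoid" and K L where H: "idem_comm_monoid H"
    and K: "\<forall>c\<in>carrier (half C). K c \<noteq> {} \<and> K c \<subseteq> carrier H"
    and L: "\<forall>u\<in>arrows C. L u \<noteq> {} \<and> L u \<subseteq> carrier H"
    and LL: "\<forall>u\<in>arrows C. \<forall>v\<in>arrows C. tgt C u = src C v \<longrightarrow>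
      (\<forall>k\<in>L u. \<forall>l\<in>L v. k \<otimes>\<^bsub>H\<^esub> l \<in> L (cmp C u v))"
    and KL: "\<forall>c\<in>carrier (half C). \<forall>u\<in>arrows C. hend C c = src C u \<longrightarrow>
      (\<forall>k\<in>K c. \<forall>l\<in>L u. k \<otimes>\<^bsub>H\<^esub> l \<in> K (hact C c u))"
    and KK: "\<forall>c\<in>carrier (half C). \<forall>d\<in>carrier (half C). \<forall>k\<in>K c. \<forall>l\<in>K d.
      k \<otimes>\<^bsub>H\<^esub> l \<in> K (c \<otimes>\<^bsub>half C\<^esub> d)"
    and LK: "\<forall>u\<in>arrows C. \<forall>c\<in>carrier (half C). \<forall>k\<in>L u. \<forall>l\<in>K c.
      k \<otimes>\<^bsub>H\<^esub> l \<in> L (ains C u c)"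
    and disL: "\<forall>u\<in>arrows C. \<forall>v\<in>arrows C. src C u = src C v \<longrightarrow> tgt C u = tgt C v \<longrightarrow> u \<noteq> v \<longrightarrow>
      L u \<inter> L v = {}"
    and disK: "\<forall>c\<in>carrier (half C). \<forall>d\<in>carrier (half C). hend C c = hend C d \<longrightarrow> c \<noteq> d \<longrightarrow>
      K c \<inter> K d = {}"
    using gic unfolding globally_idem_comm_def divides_flat_alg_iff by (elim exE conjE) (rule that)
  interpret comm_monoid H using H by (simp add: idem_comm_monoid_def)
  define E where "E = (\<lambda>u. 2 * u) ` arrows C \<union> (\<lambda>c. 2 * c + 1) ` carrier (half C)"
  \<comment> \<open>Parity merges the two families of covering sets into one, indexed by
    generators.\<close>
  define F where "F e = (if even e then L (e div 2) else K (e div 2))" for e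
  define k where "k e = (SOME h. h \<in> F e)" for e
  \<comment> \<open>The homomorphism that extends the choice of points \<open>k\<close> to sets of
    generators.\<close>
  define \<phi> where "\<phi> x = finprod H (\<lambda>h. h) (k ` {i. bit x i})" for x :: nat
  \<comment> \<open>The pullback of the covering sets. Restricting to subsets of \<open>E\<close>
    makes it finite and keeps the chosen points within the carrier of \<open>H\<close>.\<close>
  define S where "S = {(x, e). e \<in> E \<and> {i. bit x i} \<subseteq> E \<and> \<phi> x \<in> F e}"
  define r where "r = set_encode (prod_encode ` S)"
  have F: "F (2 * u) = L u" "F (2 * c + 1) = K c" for u c by (simp_all add: F_def)
  have E: "2 * u \<in> E \<longleftrightarrow> u \<in> arrows C" "2 * c + 1 \<in> E \<longleftrightarrow> c \<in> carrier (half C)" for u c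
    unfolding E_def by (auto, presburger+)
  have k: "k e \<in> F e" "k e \<in> carrier H" if "e \<in> E" for e
  proof -
    have "F e \<noteq> {} \<and> F e \<subseteq> carrier H" using that K L by (auto simp: E_def F_def)
    then show "k e \<in> F e" "k e \<in> carrier H" unfolding k_def by (auto intro: someI2_ex)
  qed
  have E_less: "E \<subseteq> {..<2 * ?m + 2}"
    using element_le_forest_cat_code[OF C] by (fastforce simp: E_def)
  have encode: "x = set_encode {i. bit x i}" for x :: nat
    using set_decode_inverse[of x] by (simp add: set_decode_def bit_iff_odd)
  have S_le: "prod_encode p < Suc (prod_encode (2 ^ (2 * ?m + 2), 2 * ?m + 2))" if pS: "p \<in> S" for p
  proof -
    obtain x e where p: "p = (x, e)" "e \<in> E" "{i. bit x i} \<subseteq> E"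
      using pS by (cases p) (auto simp: S_def)
    have "x \<le> 2 ^ (2 * ?m + 2)"
      by (subst encode) (rule set_encode_le_exp, use p(3) E_less in blast)
    moreover have "e \<le> 2 * ?m + 2" using p(2) E_less by auto
    ultimately show ?thesis using prod_encode_mono p(1) by (simp add: less_Suc_eq_le)
  qed
  then have "r \<le> certificate_bound ?m"
    unfolding r_def certificate_bound_def by (intro set_encode_le_exp) auto
  have "finite (prod_encode ` S)"
    by (rule finite_subset[of _ "{..<Suc (prod_encode (2 ^ (2 * ?m + 2), 2 * ?m + 2))}"]) (use S_le in auto)
  then have bit_r: "bit r (prod_encode p) \<longleftrightarrow> p \<in> S" for p
    by (auto simp: r_def bit_set_encode)
  \<comment> \<open>The singleton of \<open>e\<close> is coded by \<open>2 ^ e\<close>, and \<phi>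
    sends it to the chosen point of \<open>F e\<close>.\<close>
  have gen: "(2 ^ e, e) \<in> S" if "e \<in> E" for e
  proof -
    have "{i. bit (2 ^ e :: nat) i} = {e}" by (auto simp: bit_simps)
    then show ?thesis using that k[OF that] by (simp add: S_def \<phi>_def)
  qed
  \<comment> \<open>One fact serves all four operations: only the covering set that receives the
    product in \<open>H\<close> differs.\<close>
  have mult: "(or x y, g) \<in> S"
    if "(x, e) \<in> S" "(y, f) \<in> S" "g \<in> E" "\<phi> x \<otimes>\<^bsub>H\<^esub> \<phi> y \<in> F g" for x y e f g
  proof -
    have xy: "{i. bit x i} \<subseteq> E" "{i. bit y i} \<subseteq> E" using that by (auto simp: S_def)
    then have "\<phi> (or x y) = \<phi> x \<otimes>\<^bsub>H\<^esub> \<phi> y"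
      unfolding \<phi>_def by (intro finprod_image_bit_or H) (use k(2) in blast)+
    then show ?thesis using that xy by (auto simp: S_def bit_simps)
  qed
  have S: "(x, 2 * u) \<in> S \<Longrightarrow> \<phi> x \<in> L u" "(x, 2 * c + 1) \<in> S \<Longrightarrow> \<phi> x \<in> K c" for x u c
    by (auto simp: S_def F_def)
  have "certificate r ?m"
    unfolding certificate_forest_cat_code_iff[OF C] bit_r
  proof (intro conjI allI ballI impI)
    fix x y c d
    assume "c \<in> carrier (half C)" "d \<in> carrier (half C)" "(x, 2 * c + 1) \<in> S" "(y, 2 * d + 1) \<in> S"
    then show "(or x y, 2 * (c \<otimes>\<^bsub>half C\<^esub> d) + 1) \<in> S"
      by (intro mult) (use KK half_closed S in \<open>auto simp only: E F\<close>)
  next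
    fix x y u v
    assume "u \<in> arrows C" "v \<in> arrows C" "tgt C u = src C v" "(x, 2 * u) \<in> S" "(y, 2 * v) \<in> S"
    then show "(or x y, 2 * cmp C u v) \<in> S"
      by (intro mult) (use LL cmp_arrow S in \<open>auto simp only: E F\<close>)
  next
    fix x y c u
    assume "c \<in> carrier (half C)" "u \<in> arrows C" "hend C c = src C u" "(x, 2 * c + 1) \<in> S" "(y, 2 * u) \<in> S"
    then show "(or x y, 2 * hact C c u + 1) \<in> S"
      by (intro mult) (use KL hact_half S in \<open>auto simp only: E F\<close>)
  next
    fix x y u c
    assume "u \<in> arrows C" "c \<in> carrier (half C)" "(x, 2 * u) \<in> S" "(y, 2 * c + 1) \<in> S"
    then show "(or x y, 2 * ains C u c) \<in> S"
      by (intro mult) (use LK ains_arrow S in \<open>auto simp only: E F\<close>)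
  next
    fix x u v
    assume "u \<in> arrows C" "v \<in> arrows C" "src C u = src C v" "tgt C u = tgt C v"
      "(x, 2 * u) \<in> S" "(x, 2 * v) \<in> S"
    \<comment> \<open>Otherwise \<phi> x would lie in two disjoint covering sets.\<close>
    then show "u = v" using disL S by blast
  next
    fix x c d
    assume "c \<in> carrier (half C)" "d \<in> carrier (half C)" "hend C c = hend C d"
      "(x, 2 * c + 1) \<in> S" "(x, 2 * d + 1) \<in> S"
    then show "c = d" using disK S by blast
  qed (simp_all only: gen E)
  with \<open>r \<le> certificate_bound ?m\<close> show ?thesis by blast
qed

theorem theorem4:
  shows "decidable_problem forest_cat_code
           {C. finite_forest_category C} globally_idem_comm"
proof -
  obtain f where "recursive 1 f"
    and f: "f [m] = (if \<exists>r\<le>certificate_bound m. certificate r m then 1 else 0)" for m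
    using recursive_search by blast
  moreover have "f [forest_cat_code C] = (if globally_idem_comm C then 1 else 0)"
    if "finite_forest_category C" for C
    using certificate_if_globally_idem_comm[OF that] globally_idem_comm_if_certificate[OF that]
    by (auto simp: f)
  ultimately show ?thesis unfolding decidable_problem_def by blast
qed

end
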